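(* Let $K$ be a field, let $R=K[x_1,\dots,x_n]$, and let $J$ be an ideal of $R$ such that $I=\operatorname{Rad}(J)$ is a nonzero proper (squarefree) monomial ideal. Then $$\operatorname{ara} J\leq \mu(I)-\frac{\mu(I)}{\tau(I)}+1.$$
   Context: A monomial ideal is an ideal generated by monomials, i.e. by products of indeterminates; it is squarefree if it is generated by products of pairwise distinct indeterminates (radical monomial ideals are exactly the squarefree ones). For an ideal $J$ of $R$, elements $a_1,\dots,a_s\in R$ generate $J$ up to radical if $\operatorname{Rad}(a_1,\dots,a_s)=\operatorname{Rad} J$. The arithmetical rank $\operatorname{ara} J$ is the minimum number $s$ for which such elements exist. $\mu(I)$ denotes the minimum number of generators of $I$; for a monomial ideal it equals the number of monomials in $I$ that are minimal with respect to divisibility. $\tau(I)$ denotes the maximum of the heights of the minimal primes of $I$. The inequality is between rational numbers. *)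

theory Defs
  imports Complex_Main "HOL-Library.Poly_Mapping" "HOL-Library.Extended_Nat"
begin

text \<open>
  The ring \<open>K[x\<^sub>1, \<dots>, x\<^sub>n]\<close> is the type of finitely supported functions from exponent vectors
  to coefficients, with the indeterminates indexed by a finite type \<open>'n\<close>, so that \<open>n = CARD('n)\<close>.
\<close>
type_synonym ('n, 'k) mpoly = "('n \<Rightarrow>\<^sub>0 nat) \<Rightarrow>\<^sub>0 'k"

text \<open>
  The ideals of a commutative ring are the submodules of the ring regarded as a module over
  itself, and the ideal generated by a set is its span in that module.
\<close>
abbreviation is_ideal :: "'a::comm_ring_1 set \<Rightarrow> bool"
  where "is_ideal \<equiv> module.subspace (*)"

abbreviation ideal_gen :: "'a::comm_ring_1 set \<Rightarrow> 'a set"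
  where "ideal_gen \<equiv> module.span (*)"

lemma module_self: "module ((*) :: 'a::comm_ring_1 \<Rightarrow> 'a \<Rightarrow> 'a)"
  by unfold_locales (simp_all add: algebra_simps)

lemma is_ideal_iff:
  "is_ideal (J :: 'a::comm_ring_1 set) \<longleftrightarrow>
     0 \<in> J \<and> (\<forall>a\<in>J. \<forall>b\<in>J. a + b \<in> J) \<and> (\<forall>r. \<forall>a\<in>J. r * a \<in> J)"
  by (auto simp: module.subspace_def[OF module_self])

definition radical :: "'a::comm_ring_1 set \<Rightarrow> 'a set"
  where "radical J = {f. \<exists>k>0. f ^ k \<in> J}"

definition prime_ideal :: "'a::comm_ring_1 set \<Rightarrow> bool"
  where "prime_ideal P \<longleftrightarrow>
    is_ideal P \<and> P \<noteq> UNIV \<and> (\<forall>a b. a * b \<in> P \<longrightarrow> a \<in> P \<or> b \<in> P)"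

definition minimal_primes :: "'a::comm_ring_1 set \<Rightarrow> 'a set set"
  where "minimal_primes I =
    {P. prime_ideal P \<and> I \<subseteq> P \<and> (\<forall>Q. prime_ideal Q \<and> I \<subseteq> Q \<and> Q \<subseteq> P \<longrightarrow> Q = P)}"

definition height :: "'a::comm_ring_1 set \<Rightarrow> enat"
  where "height P = Sup {enat k | k. \<exists>C. (\<forall>i\<le>k. prime_ideal (C i)) \<and>
                                      (\<forall>i<k. C i \<subset> C (Suc i)) \<and> C k = P}"

text \<open>The supremum of a finite nonempty set of extended naturals is its maximum.\<close>
definition tau :: "'a::comm_ring_1 set \<Rightarrow> enat"
  where "tau I = (SUP P\<in>minimal_primes I. height P)"

definition mu :: "'a::comm_ring_1 set \<Rightarrow> nat"
  where "mu I = (LEAST s. \<exists>as. length as = s \<and> ideal_gen (set as) = I)"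

text \<open>The elements generating \<open>J\<close> up to radical need not belong to \<open>J\<close>.\<close>
definition ara :: "'a::comm_ring_1 set \<Rightarrow> nat"
  where "ara J = (LEAST s. \<exists>as. length as = s \<and> radical (ideal_gen (set as)) = radical J)"

definition monomial :: "('n \<Rightarrow>\<^sub>0 nat) \<Rightarrow> ('n, 'k::comm_ring_1) mpoly"
  where "monomial m = Poly_Mapping.single m 1"

definition monomial_ideal :: "('n, 'k::comm_ring_1) mpoly set \<Rightarrow> bool"
  where "monomial_ideal I \<longleftrightarrow> (\<exists>M. I = ideal_gen (monomial ` M))"

end

theory Submission
  imports Defs "HOL-Library.FuncSet" "HOL-Library.Cardinality"
begin

text \<open>
  Both \<open>ara J\<close> and the right-hand side depend on \<open>I\<close> alone, and \<open>I\<close> is generated by the squarefree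
  monomials \<open>x\<^sub>A\<close> (the product of the \<open>x\<^sub>i\<close> with \<open>i \<in> A\<close>) for the members \<open>A\<close> of an antichain \<open>F\<close> of
  sets of indices. Regard \<open>F\<close> as a hypergraph, and call the number of members of \<open>F\<close> that contain
  \<open>i\<close> the degree of \<open>i\<close>.

  \<^item> The minimal primes of \<open>I\<close> include the ideals generated by the variables of a minimal vertex
    cover \<open>C\<close> of \<open>F\<close>, and these have height at least \<open>|C|\<close>. As heights are finite in a polynomial ring
    over a field, \<open>|C| \<le> \<tau>(I)\<close> holds for every minimal vertex cover
    (\<open>card_minimal_vertex_cover_le_tau\<close>).

  \<^item> Some \<open>A \<in> F\<close> has all its indices of degree at least \<open>|F| / \<tau>(I)\<close>. Otherwise the indices of
    smaller degree meet every member of \<open>F\<close>, so they contain a minimal vertex cover; it has at most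
    \<open>\<tau>(I)\<close> elements, each of which lies in fewer than \<open>|F| / \<tau>(I)\<close> members of \<open>F\<close>, so it cannot
    cover all of \<open>F\<close> (\<open>ex_member_of_large_degrees\<close>).

  \<^item> Let \<open>d\<close> be the smallest degree of an index in this \<open>A\<close>, and \<open>r = |F| - d\<close>. If \<open>x\<^sub>A\<close> vanishes at a
    point, then some \<open>x\<^sub>i\<close> with \<open>i \<in> A\<close> does, and all but at most \<open>r\<close> of the other generators vanish
    with it. These few are then detected by the first \<open>r\<close> elementary symmetric functions
    \<open>e\<^sub>1, \<dots>, e\<^sub>r\<close> of the generators other than \<open>x\<^sub>A\<close>, whatever the field \<open>K\<close> is. Algebraically: \<open>x\<^sub>A\<close>
    divides every product of more than \<open>r\<close> of these generators, so the ideal \<open>(x\<^sub>A, e\<^sub>1, \<dots>, e\<^sub>r)\<close>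
    contains all the \<open>e\<^sub>j\<close> with \<open>j > r\<close>, too; by the formulas of Vieta each generator is then a root,
    modulo this ideal, of a power of the unknown (\<open>in_radical_esym\<close>). Hence \<open>ara J \<le> 1 + r\<close>
    (\<open>ara_le_of_min_degree\<close>).

  It remains to compare \<open>|F|\<close> with \<open>\<mu>(I)\<close>. The bound \<open>\<mu> - \<mu> / \<tau> + 1\<close> increases with \<open>\<mu>\<close>, so that
  \<open>|F| \<le> \<mu>(I)\<close> is what is needed: the coefficients at the minimal monomials of the elements of any
  generating system span a space of dimension \<open>|F|\<close> (\<open>card_le_generators\<close>).
\<close>


section \<open>Ideals and radicals\<close>

interpretation ideal: module "(*) :: 'a::comm_ring_1 \<Rightarrow> 'a \<Rightarrow> 'a"
  by (rule module_self)

lemma ideal_mult_left: "is_ideal J \<Longrightarrow> a \<in> J \<Longrightarrow> r * a \<in> J"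
  by (rule ideal.subspace_scale)

lemma ideal_mult_right: "is_ideal J \<Longrightarrow> a \<in> J \<Longrightarrow> a * r \<in> J"
  by (metis ideal_mult_left mult.commute)

lemma ideal_dvd: "is_ideal J \<Longrightarrow> a \<in> J \<Longrightarrow> a dvd b \<Longrightarrow> b \<in> J"
  by (auto simp: dvd_def ideal_mult_right)

lemma radicalI: "k > 0 \<Longrightarrow> a ^ k \<in> J \<Longrightarrow> a \<in> radical J"
  unfolding radical_def by blast

lemma radicalE:
  assumes "a \<in> radical J"
  obtains k where "k > 0" "a ^ k \<in> J"
  using assms unfolding radical_def by blast

lemma subset_radical: "J \<subseteq> radical J"
  unfolding radical_def by (auto intro!: exI[of _ 1])

lemma radical_mono: "J \<subseteq> J' \<Longrightarrow> radical J \<subseteq> radical J'"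
  by (auto simp: radical_def)

lemma radical_idem: "radical (radical J) = radical J"
proof
  show "radical (radical J) \<subseteq> radical J"
  proof
    fix a assume "a \<in> radical (radical J)"
    then obtain k where k: "k > 0" "a ^ k \<in> radical J" by (rule radicalE)
    obtain l where l: "l > 0" "(a ^ k) ^ l \<in> J" using k(2) by (rule radicalE)
    with k have "k * l > 0" "a ^ (k * l) \<in> J" by (simp_all add: power_mult)
    then show "a \<in> radical J" by (rule radicalI)
  qed
qed (rule subset_radical)

lemma is_ideal_radical:
  assumes J: "is_ideal J"
  shows "is_ideal (radical J)"
proof -
  have "a + b \<in> radical J" if "a \<in> radical J" "b \<in> radical J" for a b
  proof -
    obtain k where k: "k > 0" "a ^ k \<in> J" using \<open>a \<in> radical J\<close> by (rule radicalE)
    obtain l where l: "l > 0" "b ^ l \<in> J" using \<open>b \<in> radical J\<close> by (rule radicalE)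
    have "of_nat ((k + l) choose i) * a ^ i * b ^ (k + l - i) \<in> J" for i
    proof (cases "k \<le> i")
      case True
      then have "a ^ k dvd a ^ i" by (rule le_imp_power_dvd)
      then show ?thesis by (rule ideal_dvd[OF J k(2) dvd_mult2[OF dvd_mult]])
    next
      case False
      then have "b ^ l dvd b ^ (k + l - i)" by (intro le_imp_power_dvd) simp
      then show ?thesis by (rule ideal_dvd[OF J l(2) dvd_mult])
    qed
    then have "(a + b) ^ (k + l) \<in> J"
      by (subst binomial_ring) (intro ideal.subspace_sum J)
    then show ?thesis using k by (intro radicalI[of "k + l"]) auto
  qed
  moreover have "r * a \<in> radical J" if "a \<in> radical J" for r a
  proof -
    obtain k where k: "k > 0" "a ^ k \<in> J" using \<open>a \<in> radical J\<close> by (rule radicalE)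
    have "(r * a) ^ k \<in> J"
      unfolding power_mult_distrib by (rule ideal_mult_left[OF J k(2)])
    with k show ?thesis by (intro radicalI)
  qed
  moreover have "0 \<in> radical J"
    using ideal.subspace_0[OF J] subset_radical by blast
  ultimately show ?thesis unfolding is_ideal_iff by (intro conjI ballI allI)
qed

lemma prime_ideal_is_ideal: "prime_ideal P \<Longrightarrow> is_ideal P"
  by (simp only: prime_ideal_def)

lemma prime_ideal_multD:
  "prime_ideal P \<Longrightarrow> a * b \<in> P \<Longrightarrow> a \<in> P \<or> b \<in> P"
  unfolding prime_ideal_def by blast

lemma prime_ideal_no_unit:
  assumes "prime_ideal P" "u dvd 1" shows "u \<notin> P"
proof
  assume u: "u \<in> P"
  have "r \<in> P" for r
    using ideal_dvd[OF prime_ideal_is_ideal[OF assms(1)] u] dvd_trans[OF assms(2) one_dvd] .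
  then have "P = UNIV" by blast
  then show False using assms(1) unfolding prime_ideal_def by blast
qed

lemma prime_ideal_power:
  assumes "prime_ideal P" "a ^ k \<in> P" shows "a \<in> P"
  using assms(2)
proof (induction k)
  case 0
  then show ?case using prime_ideal_no_unit[OF assms(1), of 1] by simp
next
  case (Suc k)
  then show ?case using prime_ideal_multD[OF assms(1), of a "a ^ k"] by auto
qed

lemma prime_ideal_prod:
  assumes "prime_ideal P" "finite S" "prod f S \<in> P"
  shows "\<exists>s\<in>S. f s \<in> P"
  using assms(2,3)
proof (induction S rule: finite_induct)
  case empty
  then show ?case using prime_ideal_no_unit[OF assms(1), of 1] by simp
next
  case (insert s S)
  then show ?case using prime_ideal_multD[OF assms(1), of "f s" "prod f S"] by auto
qed

lemma ara_le:
  assumes "radical (ideal_gen (set as)) = radical J"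
  shows "ara J \<le> length as"
  unfolding ara_def using assms by (intro Least_le) auto


section \<open>Elementary symmetric elements\<close>

definition esym :: "('b \<Rightarrow> 'a::comm_ring_1) \<Rightarrow> 'b set \<Rightarrow> nat \<Rightarrow> 'a"
  where "esym f H j = (\<Sum>S | S \<subseteq> H \<and> card S = j. prod f S)"

text \<open>
  By the formulas of Vieta, \<open>f a\<close> is a root of the monic polynomial of degree \<open>card H\<close> whose other
  coefficients are, up to sign, the elementary symmetric elements. All of these lie in \<open>Q\<close>.
\<close>
lemma power_card_in_ideal:
  fixes f :: "'b \<Rightarrow> 'a::comm_ring_1"
  assumes Q: "is_ideal Q" and H: "finite H" "a \<in> H"
    and e: "\<And>j. 1 \<le> j \<Longrightarrow> j \<le> card H \<Longrightarrow> esym f H j \<in> Q"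
  shows "f a ^ card H \<in> Q"
proof -
  define n where "n = card H"
  have cle: "card X \<le> n" if "X \<subseteq> H" for X
    using that H by (simp add: n_def card_mono)
  \<comment> \<open>The factor for \<open>b = a\<close> is zero; expanding the product and sorting by the size of the
     subsets gives the relation between the powers of \<open>f a\<close>.\<close>
  have "0 = (\<Prod>b\<in>H. f a - f b)"
    using H by (intro prod_zero[symmetric]) auto
  also have "\<dots> = (\<Sum>X\<in>Pow H. (-1) ^ card X * prod f X * f a ^ (n - card X))"
    unfolding prod_diff_conv_sum[OF H(1)]
  proof (intro sum.cong refl)
    fix X assume "X \<in> Pow H"
    then have "card (H - X) = n - card X"
      using H(1) by (simp add: n_def card_Diff_subset finite_subset[of X H])
    then show "(-1) ^ card X * prod f X * (\<Prod>b\<in>H - X. f a) = (-1) ^ card X * prod f X * f a ^ (n - card X)"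
      by simp
  qed
  also have "\<dots> = (\<Sum>j\<le>n. \<Sum>X | X \<in> Pow H \<and> card X = j. (-1) ^ card X * prod f X * f a ^ (n - card X))"
    by (rule sum.group[symmetric]) (use H cle in auto)
  also have "\<dots> = (\<Sum>j\<le>n. (-1) ^ j * f a ^ (n - j) * esym f H j)"
  proof (intro sum.cong refl)
    fix j assume "j \<in> {..n}"
    show "(\<Sum>X | X \<in> Pow H \<and> card X = j. (-1) ^ card X * prod f X * f a ^ (n - card X))
        = (-1) ^ j * f a ^ (n - j) * esym f H j"
      unfolding esym_def sum_distrib_left
    proof (rule sum.cong)
      fix X assume "X \<in> {S. S \<subseteq> H \<and> card S = j}"
      then have "card X = j" by simp
      then show "(-1) ^ card X * prod f X * f a ^ (n - card X) = (-1) ^ j * f a ^ (n - j) * prod f X"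
        by (simp only: mult_ac)
    qed simp
  qed
  also have "\<dots> = f a ^ n + (\<Sum>j=1..n. (-1) ^ j * f a ^ (n - j) * esym f H j)"
  proof -
    have "S = {}" if "S \<subseteq> H" "card S = 0" for S
      using that finite_subset[OF _ H(1)] by auto
    then have "{S. S \<subseteq> H \<and> card S = 0} = {{}}"
      by auto
    then have "esym f H 0 = 1" by (simp add: esym_def)
    moreover have "{..n} = insert 0 {1..n}" by auto
    ultimately show ?thesis by simp
  qed
  finally have "f a ^ n = - (\<Sum>j=1..n. (-1) ^ j * f a ^ (n - j) * esym f H j)"
    by (simp add: eq_neg_iff_add_eq_0)
  also have "\<dots> \<in> Q"
    by (rule ideal.subspace_neg[OF Q ideal.subspace_sum[OF Q ideal_mult_left[OF Q e]]])
       (simp_all add: n_def)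
  finally show ?thesis by (simp add: n_def)
qed

text \<open>
  A substitute for the lemma of Schmitt and Vogel: the elementary symmetric elements of index above
  \<open>r\<close> are sums of products of more than \<open>r\<close> factors, so they are multiples of \<open>p\<close> and need not be
  listed among the generators.
\<close>
lemma in_radical_esym:
  fixes f :: "'b \<Rightarrow> 'a::comm_ring_1"
  assumes H: "finite H" "a \<in> H"
    and dvd: "\<And>S. S \<subseteq> H \<Longrightarrow> r < card S \<Longrightarrow> p dvd prod f S"
  shows "f a \<in> radical (ideal_gen (set (p # map (esym f H) [1..<Suc r])))"
    (is "_ \<in> radical ?Q")
proof -
  have Q: "is_ideal ?Q" by (rule ideal.subspace_span)
  have p: "p \<in> ?Q" by (rule ideal.span_base) simp
  have "esym f H j \<in> ?Q" if "1 \<le> j" for j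
  proof (cases "j \<le> r")
    case True
    then have "j \<in> set [1..<Suc r]" using that by (simp only: set_upt) simp
    then show ?thesis by (intro ideal.span_base) (simp only: list.set set_map insertI2 imageI)
  next
    case False
    then have "p dvd prod f S" if "S \<subseteq> H" "card S = j" for S
      using dvd that by simp
    then show ?thesis
      unfolding esym_def[of f H j] by (intro ideal.subspace_sum Q) (blast intro: ideal_dvd[OF Q p])
  qed
  then have "f a ^ card H \<in> ?Q"
    by (intro power_card_in_ideal[OF Q H]) auto
  moreover have "card H > 0" using H by (auto simp: card_gt_0_iff)
  ultimately show ?thesis by (intro radicalI)
qed


section \<open>Polynomials and monomial ideals\<close>

lemma poly_mapping_sum_single:
  "f = (\<Sum>m\<in>Poly_Mapping.keys f. Poly_Mapping.single m (Poly_Mapping.lookup f m))"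
proof (rule poly_mapping_eqI)
  fix k
  have "Poly_Mapping.lookup (\<Sum>m\<in>Poly_Mapping.keys f. Poly_Mapping.single m (Poly_Mapping.lookup f m)) k
      = (\<Sum>m\<in>Poly_Mapping.keys f. if m = k then Poly_Mapping.lookup f m else 0)"
    by (simp add: lookup_sum lookup_single when_def)
  also have "\<dots> = Poly_Mapping.lookup f k"
    by (simp add: in_keys_iff)
  finally show "Poly_Mapping.lookup f k
      = Poly_Mapping.lookup (\<Sum>m\<in>Poly_Mapping.keys f. Poly_Mapping.single m (Poly_Mapping.lookup f m)) k" ..
qed

lemma lookup_mult_keys:
  "Poly_Mapping.lookup (f * g) k =
     (\<Sum>a\<in>Poly_Mapping.keys f. \<Sum>b\<in>Poly_Mapping.keys g.
        Poly_Mapping.lookup f a * Poly_Mapping.lookup g b when k = a + b)"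
proof -
  have "f * g = (\<Sum>a\<in>Poly_Mapping.keys f. \<Sum>b\<in>Poly_Mapping.keys g.
      Poly_Mapping.single a (Poly_Mapping.lookup f a) * Poly_Mapping.single b (Poly_Mapping.lookup g b))"
    by (subst (1) poly_mapping_sum_single[of f], subst (1) poly_mapping_sum_single[of g])
       (rule sum_product)
  then show ?thesis
    by (simp add: lookup_sum mult_single lookup_single when_def eq_commute[of k])
qed

lemma monomial_eq_iff:
  "(monomial a :: ('n, 'k::comm_ring_1) mpoly) = monomial b \<longleftrightarrow> a = b"
proof
  assume "(monomial a :: ('n, 'k) mpoly) = monomial b"
  from arg_cong[OF this, of Poly_Mapping.keys] show "a = b" by (simp add: monomial_def)
qed simp

lemma in_monomial_ideal_iff:
  fixes f :: "('n, 'k::comm_ring_1) mpoly"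
  shows "f \<in> ideal_gen (monomial ` M) \<longleftrightarrow>
    (\<forall>m\<in>Poly_Mapping.keys f. \<exists>a\<in>M. \<exists>u. m = a + u)"
proof
  let ?I = "{f :: ('n, 'k) mpoly. \<forall>m\<in>Poly_Mapping.keys f. \<exists>a\<in>M. \<exists>u. m = a + u}"
  have "is_ideal ?I"
    unfolding is_ideal_iff
  proof (intro conjI ballI allI)
    show "0 \<in> ?I" by simp
    show "f + g \<in> ?I" if "f \<in> ?I" "g \<in> ?I" for f g
      using that keys_add[of f g] by blast
    show "r * f \<in> ?I" if f: "f \<in> ?I" for r f
    proof (intro CollectI ballI)
      fix m assume "m \<in> Poly_Mapping.keys (r * f)"
      then obtain v b where "b \<in> Poly_Mapping.keys f" "m = v + b"
        using keys_mult[of r f] by blast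
      moreover from this f obtain a u where "a \<in> M" "b = a + u" by blast
      ultimately have "m = a + (u + v)" by (simp add: ac_simps)
      with \<open>a \<in> M\<close> show "\<exists>a\<in>M. \<exists>u. m = a + u" by blast
    qed
  qed
  moreover have "monomial ` M \<subseteq> ?I"
  proof
    fix f :: "('n, 'k) mpoly" assume "f \<in> monomial ` M"
    then obtain a where "a \<in> M" "f = monomial a" by blast
    moreover from this have "\<exists>b\<in>M. \<exists>u. a = b + u" by (intro bexI[of _ a] exI[of _ 0]) simp_all
    ultimately show "f \<in> ?I" by (simp add: monomial_def)
  qed
  ultimately show "\<forall>m\<in>Poly_Mapping.keys f. \<exists>a\<in>M. \<exists>u. m = a + u" if "f \<in> ideal_gen (monomial ` M)"
    using ideal.span_minimal[of "monomial ` M" ?I] that by blast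
next
  assume f: "\<forall>m\<in>Poly_Mapping.keys f. \<exists>a\<in>M. \<exists>u. m = a + u"
  have "(\<Sum>m\<in>Poly_Mapping.keys f. Poly_Mapping.single m (Poly_Mapping.lookup f m)) \<in> ideal_gen (monomial ` M)"
  proof (rule ideal.span_sum)
    fix m assume "m \<in> Poly_Mapping.keys f"
    then obtain a u where a: "a \<in> M" "m = a + u" using f by blast
    then have "Poly_Mapping.single m (Poly_Mapping.lookup f m)
        = Poly_Mapping.single u (Poly_Mapping.lookup f m) * monomial a"
      by (simp add: monomial_def mult_single add.commute)
    also have "\<dots> \<in> ideal_gen (monomial ` M)"
      using a by (intro ideal.span_scale ideal.span_base imageI)
    finally show "Poly_Mapping.single m (Poly_Mapping.lookup f m) \<in> ideal_gen (monomial ` M)" .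
  qed
  then show "f \<in> ideal_gen (monomial ` M)"
    by (subst poly_mapping_sum_single)
qed

definition sqf_exp :: "'n set \<Rightarrow> 'n::finite \<Rightarrow>\<^sub>0 nat"
  where "sqf_exp A = (\<Sum>i\<in>A. Poly_Mapping.single i 1)"

definition sqf_monomial :: "'n::finite set \<Rightarrow> ('n, 'k::comm_ring_1) mpoly"
  where "sqf_monomial A = monomial (sqf_exp A)"

definition sqf_ideal :: "'n::finite set set \<Rightarrow> ('n, 'k::comm_ring_1) mpoly set"
  where "sqf_ideal F = ideal_gen (sqf_monomial ` F)"

lemma lookup_sqf_exp: "Poly_Mapping.lookup (sqf_exp A) i = (if i \<in> A then 1 else 0)"
  by (simp add: sqf_exp_def lookup_sum lookup_single when_def)

lemma keys_sqf_exp [simp]: "Poly_Mapping.keys (sqf_exp A) = A"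
  by (auto simp: in_keys_iff lookup_sqf_exp split: if_splits)

lemma keys_add_nat:
  fixes a b :: "'n \<Rightarrow>\<^sub>0 nat"
  shows "Poly_Mapping.keys (a + b) = Poly_Mapping.keys a \<union> Poly_Mapping.keys b"
  by (auto simp: in_keys_iff lookup_add)

lemma keys_sum_nat:
  fixes a :: "'b \<Rightarrow> 'n \<Rightarrow>\<^sub>0 nat"
  assumes "finite S"
  shows "Poly_Mapping.keys (sum a S) = (\<Union>s\<in>S. Poly_Mapping.keys (a s))"
  using assms by (induction S rule: finite_induct) (simp_all add: keys_add_nat)

lemma exponent_le_imp_add:
  fixes a m :: "'n \<Rightarrow>\<^sub>0 nat"
  assumes "\<And>i. Poly_Mapping.lookup a i \<le> Poly_Mapping.lookup m i"
  shows "m = a + (m - a)"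
  using assms by (intro poly_mapping_eqI) (simp add: lookup_add lookup_minus)

text \<open>
  Divisibility of monomials becomes inclusion of supports as soon as the divisor is squarefree.
\<close>
lemma sqf_exp_divides_iff: "(\<exists>u. m = sqf_exp A + u) \<longleftrightarrow> A \<subseteq> Poly_Mapping.keys m"
proof
  assume "A \<subseteq> Poly_Mapping.keys m"
  then have "m = sqf_exp A + (m - sqf_exp A)"
    by (intro exponent_le_imp_add) (auto simp: lookup_sqf_exp in_keys_iff Suc_le_eq)
  then show "\<exists>u. m = sqf_exp A + u" ..
qed (auto simp: keys_add_nat)

lemma in_sqf_ideal_iff:
  fixes f :: "('n::finite, 'k::comm_ring_1) mpoly"
  shows "f \<in> sqf_ideal F \<longleftrightarrow> (\<forall>m\<in>Poly_Mapping.keys f. \<exists>A\<in>F. A \<subseteq> Poly_Mapping.keys m)"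
proof -
  have "(sqf_monomial ` F :: ('n, 'k) mpoly set) = monomial ` (sqf_exp ` F)"
    by (simp add: image_image sqf_monomial_def)
  then show ?thesis
    unfolding sqf_ideal_def by (simp only: in_monomial_ideal_iff bex_simps sqf_exp_divides_iff)
qed

lemma keys_sqf_monomial [simp]:
  "Poly_Mapping.keys (sqf_monomial A :: ('n::finite, 'k::comm_ring_1) mpoly) = {sqf_exp A}"
  by (simp add: sqf_monomial_def monomial_def)

lemma sqf_monomial_in_sqf_ideal_iff:
  "(sqf_monomial A :: ('n::finite, 'k::comm_ring_1) mpoly) \<in> sqf_ideal F \<longleftrightarrow> (\<exists>B\<in>F. B \<subseteq> A)"
  by (simp add: in_sqf_ideal_iff)

lemma is_ideal_sqf_ideal: "is_ideal (sqf_ideal F)"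
  unfolding sqf_ideal_def by (rule ideal.subspace_span)

lemma monomial_prod:
  "finite S \<Longrightarrow> (\<Prod>s\<in>S. monomial (a s)) = monomial (sum a S)"
  by (induction S rule: finite_induct) (simp_all add: monomial_def mult_single)

lemma sqf_monomial_conv_prod:
  "sqf_monomial A = (\<Prod>i\<in>A. sqf_monomial {i})"
  by (simp add: sqf_monomial_def monomial_prod) (simp add: sqf_exp_def)

lemma sqf_monomial_dvd_prod:
  fixes S :: "'n::finite set set"
  assumes "A \<subseteq> \<Union>S"
  shows "(sqf_monomial A :: ('n, 'k::comm_ring_1) mpoly) dvd (\<Prod>B\<in>S. sqf_monomial B)"
proof -
  have "A \<subseteq> Poly_Mapping.keys (sum sqf_exp S)"
    using assms by (simp add: keys_sum_nat)
  then obtain u where "sum sqf_exp S = sqf_exp A + u"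
    using sqf_exp_divides_iff by blast
  then have "(\<Prod>B\<in>S. sqf_monomial B :: ('n, 'k) mpoly) = sqf_monomial A * monomial u"
    by (simp add: sqf_monomial_def monomial_prod) (simp add: monomial_def mult_single)
  then show ?thesis by simp
qed

text \<open>
  If a monomial lies in a radical ideal, so does its squarefree part, a power of which it divides.
  Hence the squarefree monomials in the ideal generate it, and it suffices to keep the ones that
  are minimal under division.
\<close>
lemma radical_monomial_ideal_squarefree:
  fixes J :: "('n::finite, 'k::comm_ring_1) mpoly set"
  assumes J: "is_ideal J" and mon: "monomial_ideal (radical J)"
  obtains F where "\<And>A B. A \<in> F \<Longrightarrow> B \<in> F \<Longrightarrow> A \<subseteq> B \<Longrightarrow> A = B" "radical J = sqf_ideal F"
proof -
  define I where "I = radical J"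
  have I: "is_ideal I" unfolding I_def by (rule is_ideal_radical[OF J])
  obtain M where M: "I = ideal_gen (monomial ` M)"
    using mon unfolding I_def monomial_ideal_def by blast
  define E where "E = {A. (sqf_monomial A :: ('n, 'k) mpoly) \<in> I}"
  define F where "F = {A \<in> E. \<forall>B\<in>E. B \<subseteq> A \<longrightarrow> A = B}"
  have "I = sqf_ideal F"
  proof
    have "sqf_monomial ` F \<subseteq> I" by (auto simp: F_def E_def)
    then show "sqf_ideal F \<subseteq> I"
      unfolding sqf_ideal_def by (rule ideal.span_minimal) (rule I)
    show "I \<subseteq> sqf_ideal F"
    proof
      fix f assume "f \<in> I"
      have "\<exists>A\<in>F. A \<subseteq> Poly_Mapping.keys m" if m: "m \<in> Poly_Mapping.keys f" for m
      proof -
        obtain a u where a: "a \<in> M" "m = a + u"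
          using \<open>f \<in> I\<close> m unfolding M in_monomial_ideal_iff by blast
        \<comment> \<open>Any exponent that bounds all those of \<open>a\<close> would do; it must be positive for the radical.\<close>
        define k where "k = Suc (\<Sum>i\<in>UNIV. Poly_Mapping.lookup a i)"
        define A where "A = Poly_Mapping.keys a"
        have "Poly_Mapping.lookup a i \<le> Poly_Mapping.lookup (\<Sum>j<k. sqf_exp A) i" for i
        proof -
          have "Poly_Mapping.lookup a i \<le> k"
            unfolding k_def by (intro le_SucI member_le_sum) auto
          then show ?thesis
            by (auto simp: lookup_sum lookup_sqf_exp A_def in_keys_iff)
        qed
        from exponent_le_imp_add[OF this]
        have "\<exists>u. (\<Sum>j<k. sqf_exp A) = a + u" by blast
        moreover have "(sqf_monomial A :: ('n, 'k) mpoly) ^ k = monomial (\<Sum>j<k. sqf_exp A)"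
          using monomial_prod[of "{..<k}" "\<lambda>_. sqf_exp A"] by (simp add: sqf_monomial_def)
        ultimately have "(sqf_monomial A :: ('n, 'k) mpoly) ^ k \<in> I"
          unfolding M in_monomial_ideal_iff using a(1) by (auto simp: monomial_def)
        then have "sqf_monomial A \<in> radical I"
          by (intro radicalI[of k]) (simp add: k_def)
        then have "A \<in> E" unfolding E_def I_def radical_idem by simp
        then obtain B where "B \<in> E" "B \<subseteq> A" "\<forall>C\<in>E. C \<subseteq> B \<longrightarrow> B = C"
          using finite_has_minimal2[of E A] by (auto simp: finite)
        then have "B \<in> F" by (simp add: F_def)
        moreover have "A \<subseteq> Poly_Mapping.keys m" by (simp add: a A_def keys_add_nat)
        ultimately show ?thesis using \<open>B \<subseteq> A\<close> by blast
      qed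
      then show "f \<in> sqf_ideal F" by (simp add: in_sqf_ideal_iff)
    qed
  qed
  moreover have "A = B" if "A \<in> F" "B \<in> F" "A \<subseteq> B" for A B
    using that by (auto simp: F_def)
  ultimately show ?thesis using that unfolding I_def by blast
qed

section \<open>The number of generators\<close>

text \<open>
  Scalars act through the constant polynomials, so that the ring multiplication provides the
  vector space structure.
\<close>
interpretation mpoly: vector_space "\<lambda>(c::'k::field) (p::('n \<Rightarrow>\<^sub>0 nat) \<Rightarrow>\<^sub>0 'k). Poly_Mapping.single 0 c * p"
proof
  fix a b :: 'k and x y :: "('n, 'k) mpoly"
  show "Poly_Mapping.single 0 a * (Poly_Mapping.single 0 b * x) = Poly_Mapping.single 0 (a * b) * x"
    by (simp add: mult_single flip: mult.assoc)
qed (simp_all add: algebra_simps single_add)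

lemma lookup_scale:
  fixes f :: "('n, 'k::comm_ring_1) mpoly"
  shows "Poly_Mapping.lookup (Poly_Mapping.single 0 c * f) m = c * Poly_Mapping.lookup f m"
proof (cases "c = 0")
  case False
  then show ?thesis
    by (simp add: lookup_mult_keys when_def in_keys_iff)
qed simp

lemma independent_monomials:
  "mpoly.independent (monomial ` (M :: ('n \<Rightarrow>\<^sub>0 nat) set) :: ('n, 'k::field) mpoly set)"
  unfolding mpoly.independent_explicit_module
proof (intro allI impI)
  fix t u and v :: "('n, 'k) mpoly"
  assume t: "finite t" "t \<subseteq> monomial ` M" "(\<Sum>v\<in>t. Poly_Mapping.single 0 (u v) * v) = 0" "v \<in> t"
  then obtain m where m: "v = monomial m" by blast
  have "0 = Poly_Mapping.lookup (\<Sum>v\<in>t. Poly_Mapping.single 0 (u v) * v) m"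
    unfolding t(3) by simp
  also have "\<dots> = (\<Sum>w\<in>t. u w * Poly_Mapping.lookup w m)"
    by (simp add: lookup_sum lookup_scale)
  also have "\<dots> = (\<Sum>w\<in>t. if w = v then u w else 0)"
  proof (intro sum.cong refl)
    fix w assume "w \<in> t"
    then obtain l where "w = monomial l" using t(2) by blast
    then show "u w * Poly_Mapping.lookup w m = (if w = v then u w else 0)"
      using m by (simp add: monomial_eq_iff) (simp add: monomial_def lookup_single)
  qed
  also have "\<dots> = u v" using t by simp
  finally show "u v = 0" by simp
qed

text \<open>
  This is Nakayama's lemma made explicit. For an element \<open>f\<close> of the ideal and a minimal monomial
  \<open>c\<close>, the coefficient of \<open>r * f\<close> at \<open>c\<close> only involves the constant coefficient of \<open>r\<close>, since no other
  monomial of the ideal divides \<open>c\<close>. Therefore the projection \<open>\<phi>\<close> to the coefficients at the minimal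
  monomials turns ideal combinations of the generators into linear combinations, and the images of
  the generators span all the minimal monomials.
\<close>
lemma card_le_generators:
  fixes M :: "('n::finite \<Rightarrow>\<^sub>0 nat) set"
  assumes fin: "finite M"
    and antichain: "\<And>a b u. a \<in> M \<Longrightarrow> b \<in> M \<Longrightarrow> b = a + u \<Longrightarrow> a = b"
    and gen: "ideal_gen (set as) = ideal_gen (monomial ` M :: ('n, 'k::field) mpoly set)"
  shows "card M \<le> length as"
proof -
  define \<phi> where "\<phi> f = (\<Sum>c\<in>M. Poly_Mapping.single c (Poly_Mapping.lookup f c))" for f :: "('n, 'k) mpoly"
  have \<phi>_add: "\<phi> (f + g) = \<phi> f + \<phi> g" for f g
    by (simp add: \<phi>_def lookup_add single_add sum.distrib)
  have coeff: "Poly_Mapping.lookup (r * f) c = Poly_Mapping.lookup r 0 * Poly_Mapping.lookup f c"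
    if f: "f \<in> ideal_gen (monomial ` M)" and c: "c \<in> M" for r f :: "('n, 'k) mpoly" and c
  proof -
    have *: "u = 0 \<and> c = b" if "b \<in> Poly_Mapping.keys f" "c = u + b" for u b
    proof -
      obtain a v where "a \<in> M" "b = a + v" using f \<open>b \<in> _\<close> by (auto simp: in_monomial_ideal_iff)
      then have "a = c" using antichain[of a c "u + v"] c that by (simp add: ac_simps)
      then have "u + v = 0" using that \<open>b = a + v\<close> by (simp add: ac_simps)
      then have "Poly_Mapping.keys u = {}" using keys_add_nat[of u v] by simp
      then have "u = 0" by simp
      with that show ?thesis by simp
    qed
    have "Poly_Mapping.lookup (r * f) c = (\<Sum>u\<in>Poly_Mapping.keys r. \<Sum>b\<in>Poly_Mapping.keys f.
        if u = 0 \<and> c = b then Poly_Mapping.lookup r u * Poly_Mapping.lookup f b else 0)"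
      unfolding lookup_mult_keys when_def using * by (intro sum.cong refl if_cong) auto
    also have "\<dots> = (\<Sum>u\<in>Poly_Mapping.keys r. if u = 0 then Poly_Mapping.lookup r 0 * Poly_Mapping.lookup f c else 0)"
      by (intro sum.cong refl) (auto simp: in_keys_iff)
    also have "\<dots> = Poly_Mapping.lookup r 0 * Poly_Mapping.lookup f c"
      by (auto simp: in_keys_iff)
    finally show ?thesis .
  qed
  have \<phi>_mult: "\<phi> (r * f) = Poly_Mapping.single 0 (Poly_Mapping.lookup r 0) * \<phi> f"
    if "f \<in> ideal_gen (monomial ` M)" for r f
    using that by (simp add: \<phi>_def coeff sum_distrib_left mult_single)
  have "monomial ` M \<subseteq> mpoly.span (\<phi> ` set as)"
  proof
    fix p :: "('n, 'k) mpoly" assume p: "p \<in> monomial ` M"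
    then have "p \<in> ideal_gen (set as)" unfolding gen by (rule ideal.span_base)
    then have "\<phi> p \<in> mpoly.span (\<phi> ` set as)"
    proof (induction rule: ideal.span_induct_alt)
      case base
      have "\<phi> 0 = 0" by (simp add: \<phi>_def)
      then show ?case by (simp add: mpoly.span_zero)
    next
      case (step c x y)
      have "x \<in> ideal_gen (monomial ` M)"
        using step(1) gen ideal.span_base by blast
      then show ?case
        unfolding \<phi>_add by (simp only: \<phi>_mult)
           (intro mpoly.span_add mpoly.span_scale mpoly.span_base step imageI)
    qed
    moreover have "\<phi> p = p"
    proof -
      obtain a where "a \<in> M" "p = Poly_Mapping.single a 1" using p by (auto simp: monomial_def)
      then have "\<phi> p = (\<Sum>c\<in>M. if c = a then Poly_Mapping.single a 1 else 0)"
        unfolding \<phi>_def by (intro sum.cong refl) (auto simp: lookup_single)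
      then show ?thesis using \<open>a \<in> M\<close> \<open>p = _\<close> fin by simp
    qed
    ultimately show "p \<in> mpoly.span (\<phi> ` set as)" by simp
  qed
  then have "card (monomial ` M :: ('n, 'k) mpoly set) \<le> card (\<phi> ` set as)"
    using mpoly.independent_span_bound[OF _ independent_monomials] by blast
  moreover have "inj_on (monomial :: _ \<Rightarrow> ('n, 'k) mpoly) M"
    by (rule inj_onI) (simp add: monomial_eq_iff)
  ultimately have "card M \<le> card (\<phi> ` set as)" by (simp add: card_image)
  also have "\<dots> \<le> length as"
    by (meson List.finite_set card_image_le card_length order_trans)
  finally show ?thesis .
qed

lemma card_le_mu_sqf_ideal:
  fixes F :: "'n::finite set set"
  assumes antichain: "\<And>A B. A \<in> F \<Longrightarrow> B \<in> F \<Longrightarrow> A \<subseteq> B \<Longrightarrow> A = B"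
  shows "card F \<le> mu (sqf_ideal F :: ('n, 'k::field) mpoly set)"
proof -
  let ?I = "sqf_ideal F :: ('n, 'k) mpoly set"
  obtain bs where "set bs = (sqf_monomial ` F :: ('n, 'k) mpoly set)"
    using finite_list[of "sqf_monomial ` F"] by auto
  then have "\<exists>s as. length as = s \<and> ideal_gen (set as) = ?I"
    by (intro exI[of _ "length bs"] exI[of _ bs]) (simp add: sqf_ideal_def)
  from LeastI_ex[OF this] obtain as where as: "length as = mu ?I" "ideal_gen (set as) = ?I"
    unfolding mu_def by blast
  have "inj_on sqf_exp F"
    by (rule inj_onI) (metis keys_sqf_exp)
  then have "card F = card (sqf_exp ` F)" by (simp add: card_image)
  also have "\<dots> \<le> length as"
  proof (rule card_le_generators)
    fix a b u assume "a \<in> sqf_exp ` F" "b \<in> sqf_exp ` F" "b = a + u"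
    then obtain A B where AB: "A \<in> F" "B \<in> F" "a = sqf_exp A" "b = sqf_exp B" by blast
    then have "\<exists>u. sqf_exp B = sqf_exp A + u" using \<open>b = a + u\<close> by (intro exI[of _ u]) simp
    then have "A \<subseteq> B" unfolding sqf_exp_divides_iff by simp
    then show "a = b" using AB antichain by blast
  next
    show "ideal_gen (set as) = ideal_gen (monomial ` sqf_exp ` F :: ('n, 'k) mpoly set)"
      unfolding as(2) sqf_ideal_def by (simp add: image_image sqf_monomial_def)
  qed simp
  finally show ?thesis using as by simp
qed


section \<open>Coordinate primes\<close>

definition coord_ideal :: "'n::finite set \<Rightarrow> ('n, 'k::comm_ring_1) mpoly set"
  where "coord_ideal C = sqf_ideal ((\<lambda>i. {i}) ` C)"

lemma in_coord_ideal_iff: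
  "f \<in> coord_ideal C \<longleftrightarrow> (\<forall>m\<in>Poly_Mapping.keys f. C \<inter> Poly_Mapping.keys m \<noteq> {})"
  by (auto simp: coord_ideal_def in_sqf_ideal_iff)

lemma variable_in_coord_ideal_iff:
  "(sqf_monomial {i} :: ('n::finite, 'k::comm_ring_1) mpoly) \<in> coord_ideal C \<longleftrightarrow> i \<in> C"
  by (simp add: in_coord_ideal_iff)

text \<open>
  A replacement for leading terms: no order on the indeterminates is fixed, so the pair \<open>(a, b)\<close> is
  found by maximizing one coordinate after the other in \<open>F\<close> and in \<open>G\<close>. The set \<open>X\<close> contains the
  coordinates that are not yet constant.
\<close>
lemma unique_sum_of_exponents:
  fixes F G :: "('n \<Rightarrow>\<^sub>0 nat) set"
  assumes "finite X" "finite F" "finite G" "F \<noteq> {}" "G \<noteq> {}"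
    and "\<And>u v i. u \<in> F \<Longrightarrow> v \<in> F \<Longrightarrow> i \<notin> X \<Longrightarrow> Poly_Mapping.lookup u i = Poly_Mapping.lookup v i"
    and "\<And>u v i. u \<in> G \<Longrightarrow> v \<in> G \<Longrightarrow> i \<notin> X \<Longrightarrow> Poly_Mapping.lookup u i = Poly_Mapping.lookup v i"
  shows "\<exists>a\<in>F. \<exists>b\<in>G. \<forall>u\<in>F. \<forall>v\<in>G. u + v = a + b \<longrightarrow> u = a \<and> v = b"
  using assms
proof (induction X arbitrary: F G rule: finite_induct)
  case empty
  then obtain a b where "a \<in> F" "b \<in> G" by blast
  moreover have "u = a" if "u \<in> F" for u
    using empty(5)[OF that \<open>a \<in> F\<close>] by (intro poly_mapping_eqI) simp
  moreover have "v = b" if "v \<in> G" for v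
    using empty(6)[OF that \<open>b \<in> G\<close>] by (intro poly_mapping_eqI) simp
  ultimately show ?case by blast
next
  case (insert i X)
  define top where "top S = {u \<in> S. \<forall>v\<in>S. Poly_Mapping.lookup v i \<le> Poly_Mapping.lookup u i}"
    for S :: "('n \<Rightarrow>\<^sub>0 nat) set"
  have top_ne: "top S \<noteq> {}" if S: "finite S" "S \<noteq> {}" for S
  proof -
    let ?L = "(\<lambda>u. Poly_Mapping.lookup u i) ` S"
    have "Max ?L \<in> ?L" using S by (intro Max_in) auto
    then obtain u where "u \<in> S" "Poly_Mapping.lookup u i = Max ?L" by auto
    moreover have "\<forall>v\<in>S. Poly_Mapping.lookup v i \<le> Max ?L" using S by auto
    ultimately show ?thesis unfolding top_def by auto
  qed
  have "\<exists>a\<in>top F. \<exists>b\<in>top G. \<forall>u\<in>top F. \<forall>v\<in>top G. u + v = a + b \<longrightarrow> u = a \<and> v = b"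
  proof (rule insert.IH)
    show "finite (top F)" "finite (top G)" using insert.prems(1,2) by (auto simp: top_def)
    show "top F \<noteq> {}" "top G \<noteq> {}" using top_ne insert.prems(1-4) by auto
  next
    fix u v j assume "u \<in> top F" "v \<in> top F" "j \<notin> X"
    then show "Poly_Mapping.lookup u j = Poly_Mapping.lookup v j"
      using insert.prems(5)[of u v j] by (cases "j = i") (auto simp: top_def intro: order_antisym)
  next
    fix u v j assume "u \<in> top G" "v \<in> top G" "j \<notin> X"
    then show "Poly_Mapping.lookup u j = Poly_Mapping.lookup v j"
      using insert.prems(6)[of u v j] by (cases "j = i") (auto simp: top_def intro: order_antisym)
  qed
  then obtain a b where ab: "a \<in> top F" "b \<in> top G"
    "\<And>u v. u \<in> top F \<Longrightarrow> v \<in> top G \<Longrightarrow> u + v = a + b \<Longrightarrow> u = a \<and> v = b" by blast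
  have "u = a \<and> v = b" if uv: "u \<in> F" "v \<in> G" "u + v = a + b" for u v
  proof (rule ab(3)[OF _ _ uv(3)])
    have sum: "Poly_Mapping.lookup u i + Poly_Mapping.lookup v i
        = Poly_Mapping.lookup a i + Poly_Mapping.lookup b i"
      using arg_cong[OF uv(3), of "\<lambda>m. Poly_Mapping.lookup m i"] by (simp add: lookup_add)
    have le: "Poly_Mapping.lookup u i \<le> Poly_Mapping.lookup a i"
      "Poly_Mapping.lookup v i \<le> Poly_Mapping.lookup b i"
      using ab(1,2) uv(1,2) by (auto simp: top_def)
    with sum have "Poly_Mapping.lookup u i = Poly_Mapping.lookup a i"
      "Poly_Mapping.lookup v i = Poly_Mapping.lookup b i" by linarith+
    then show "u \<in> top F" "v \<in> top G" using uv(1,2) ab(1,2) by (auto simp: top_def)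
  qed
  moreover have "a \<in> F" "b \<in> G" using ab(1,2) by (auto simp: top_def)
  ultimately show ?case by blast
qed

text \<open>
  Modulo the ideal only the monomials without variables from \<open>C\<close> matter. Among these, two
  polynomials outside the ideal have a pair of monomials whose product occurs only once in the
  product of the polynomials, so it cannot cancel.
\<close>
lemma prime_ideal_coord_ideal:
  "prime_ideal (coord_ideal C :: ('n::finite, 'k::field) mpoly set)"
  unfolding prime_ideal_def
proof (intro conjI allI impI)
  let ?P = "coord_ideal C :: ('n, 'k) mpoly set"
  show "is_ideal ?P" unfolding coord_ideal_def by (rule is_ideal_sqf_ideal)
  have "(1 :: ('n, 'k) mpoly) \<notin> ?P" by (simp add: in_coord_ideal_iff)
  then show "?P \<noteq> UNIV" by blast
next
  fix f g :: "('n, 'k) mpoly"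
  assume fg: "f * g \<in> coord_ideal C"
  show "f \<in> coord_ideal C \<or> g \<in> coord_ideal C"
  proof (rule ccontr)
    assume neg: "\<not> (f \<in> coord_ideal C \<or> g \<in> coord_ideal C)"
    define red where "red h = {m \<in> Poly_Mapping.keys h. C \<inter> Poly_Mapping.keys m = {}}"
      for h :: "('n, 'k) mpoly"
    have fin: "finite (red f)" "finite (red g)" by (simp_all add: red_def)
    have ne: "red f \<noteq> {}" "red g \<noteq> {}" using neg by (auto simp: red_def in_coord_ideal_iff)
    have "\<exists>a\<in>red f. \<exists>b\<in>red g. \<forall>u\<in>red f. \<forall>v\<in>red g. u + v = a + b \<longrightarrow> u = a \<and> v = b"
      by (rule unique_sum_of_exponents[of UNIV]) (use fin ne in auto)
    then obtain a b where ab: "a \<in> red f" "b \<in> red g"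
      and uniq: "\<And>u v. u \<in> red f \<Longrightarrow> v \<in> red g \<Longrightarrow> u + v = a + b \<Longrightarrow> u = a \<and> v = b"
      by blast
    have disj: "C \<inter> Poly_Mapping.keys (a + b) = {}"
      using ab by (auto simp: red_def keys_add_nat)
    have uniq': "u = a \<and> v = b"
      if "u \<in> Poly_Mapping.keys f" "v \<in> Poly_Mapping.keys g" "a + b = u + v" for u v
      using that disj by (intro uniq) (auto simp: red_def keys_add_nat)
    have a: "a \<in> Poly_Mapping.keys f" and b: "b \<in> Poly_Mapping.keys g" using ab by (auto simp: red_def)
    have "Poly_Mapping.lookup (f * g) (a + b) = (\<Sum>u\<in>Poly_Mapping.keys f. \<Sum>v\<in>Poly_Mapping.keys g.
        if u = a \<and> v = b then Poly_Mapping.lookup f u * Poly_Mapping.lookup g v else 0)"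
      unfolding lookup_mult_keys when_def using uniq' by (intro sum.cong refl if_cong) auto
    also have "\<dots> = (\<Sum>u\<in>Poly_Mapping.keys f. if u = a then Poly_Mapping.lookup f a * Poly_Mapping.lookup g b else 0)"
      using b by (intro sum.cong refl) auto
    also have "\<dots> = Poly_Mapping.lookup f a * Poly_Mapping.lookup g b"
      using a by simp
    finally have "Poly_Mapping.lookup (f * g) (a + b) \<noteq> 0"
      using a b by (simp add: in_keys_iff)
    then have "a + b \<in> Poly_Mapping.keys (f * g)" by (simp add: in_keys_iff)
    then show False using fg disj by (auto simp: in_coord_ideal_iff)
  qed
qed

lemma coord_ideal_strict_mono:
  assumes "A \<subset> B"
  shows "(coord_ideal A :: ('n::finite, 'k::field) mpoly set) \<subset> coord_ideal B"
proof -
  obtain i where i: "i \<in> B" "i \<notin> A" using assms by blast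
  have "(sqf_monomial {i} :: ('n, 'k) mpoly) \<in> coord_ideal B - coord_ideal A"
    using i by (simp add: variable_in_coord_ideal_iff)
  moreover have "(coord_ideal A :: ('n, 'k) mpoly set) \<subseteq> coord_ideal B"
    unfolding coord_ideal_def sqf_ideal_def using assms by (intro ideal.span_mono) blast
  ultimately show ?thesis by blast
qed

text \<open>
  Adding the variables in \<open>C\<close> one at a time gives a chain of primes of length \<open>card C\<close>.
\<close>
lemma card_le_height_coord_ideal:
  "enat (card C) \<le> height (coord_ideal C :: ('n::finite, 'k::field) mpoly set)"
proof -
  obtain h where h: "bij_betw h {..<card C} C"
    using ex_bij_betw_nat_finite[of C] by (auto simp: lessThan_atLeast0)
  define Q :: "nat \<Rightarrow> ('n, 'k) mpoly set" where "Q k = coord_ideal (h ` {..<k})" for k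
  have "Q i \<subset> Q (Suc i)" if "i < card C" for i
    unfolding Q_def
  proof (rule coord_ideal_strict_mono)
    have "h i \<notin> h ` {..<i}"
      using h that unfolding bij_betw_def inj_on_def by fastforce
    then show "h ` {..<i} \<subset> h ` {..<Suc i}" by (auto simp: lessThan_Suc)
  qed
  moreover have "prime_ideal (Q i)" for i
    unfolding Q_def by (rule prime_ideal_coord_ideal)
  moreover have "Q (card C) = coord_ideal C"
    using h by (simp add: Q_def bij_betw_def)
  ultimately have "\<exists>Q. (\<forall>i\<le>card C. prime_ideal (Q i)) \<and> (\<forall>i<card C. Q i \<subset> Q (Suc i)) \<and>
      Q (card C) = (coord_ideal C :: ('n, 'k) mpoly set)"
    by (intro exI[of _ Q]) simp
  then show ?thesis unfolding height_def by (intro Sup_upper) blast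
qed


section \<open>Heights in polynomial rings are finite\<close>

definition list_power :: "'a::comm_ring_1 list \<Rightarrow> nat list \<Rightarrow> 'a"
  where "list_power xs as = prod_list (map2 (^) xs as)"

text \<open>
  Elements chosen from the successive differences of a chain of primes are algebraically independent
  modulo the smallest prime: in a relation, the least power of the first element can be cancelled,
  as this element is outside \<open>C 0\<close>. As it lies in \<open>C 1\<close>, only the terms without it survive modulo
  \<open>C 1\<close>, and they form a relation between the other elements. The coefficients are arbitrary units;
  in a polynomial ring over a field they are the nonzero constants.
\<close>
lemma prime_chain_independent:
  fixes C :: "nat \<Rightarrow> 'a::comm_ring_1 set"
  assumes "\<And>i. i \<le> length xs \<Longrightarrow> prime_ideal (C i)"
    and "\<And>i. i < length xs \<Longrightarrow> C i \<subseteq> C (Suc i)"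
    and "\<And>i. i < length xs \<Longrightarrow> xs ! i \<in> C (Suc i) - C i"
    and "finite S" "S \<noteq> {}" "\<And>as. as \<in> S \<Longrightarrow> length as = length xs"
    and "\<And>as. as \<in> S \<Longrightarrow> c as dvd 1"
  shows "(\<Sum>as\<in>S. c as * list_power xs as) \<notin> C 0"
  using assms
proof (induction xs arbitrary: C S c)
  case Nil
  then have "S = {[]}" by auto
  then have "(\<Sum>as\<in>S. c as * list_power [] as) dvd 1"
    using Nil.prems(7) by (simp add: list_power_def)
  moreover have "prime_ideal (C 0)" using Nil.prems(1) by simp
  ultimately show ?case
    by (intro prime_ideal_no_unit)
next
  case (Cons x xs)
  define e where "e = Min (hd ` S)"
  define S0 where "S0 = {as \<in> S. hd as = e}"
  have fin: "finite S" by fact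
  have e_le: "e \<le> hd as" if "as \<in> S" for as
    using that fin by (simp add: e_def)
  have "e \<in> hd ` S" unfolding e_def using fin Cons.prems(5) by (intro Min_in) auto
  then have S0: "S0 \<noteq> {}" "finite S0" "S0 \<subseteq> S" using fin by (auto simp: S0_def)
  have P0: "prime_ideal (C 0)" and P1: "prime_ideal (C 1)"
    using Cons.prems(1)[of 0] Cons.prems(1)[of 1] by auto
  have x: "x \<in> C 1" "x \<notin> C 0" using Cons.prems(3)[of 0] by auto
  have ex: "as = hd as # tl as" if "as \<in> S" for as
    using Cons.prems(6)[OF that] by (cases as) auto
  have lp: "list_power (x # xs) as = x ^ hd as * list_power xs (tl as)" if "as \<in> S" for as
    by (subst ex[OF that]) (simp add: list_power_def)
  define g where "g as = c as * list_power xs (tl as)" for as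
  show ?case
  proof
    assume "(\<Sum>as\<in>S. c as * list_power (x # xs) as) \<in> C 0"
    also have "(\<Sum>as\<in>S. c as * list_power (x # xs) as) = x ^ e * (\<Sum>as\<in>S. x ^ (hd as - e) * g as)"
      unfolding sum_distrib_left
    proof (intro sum.cong refl)
      fix as assume as: "as \<in> S"
      have "x ^ hd as = x ^ e * x ^ (hd as - e)"
        using e_le[OF as] by (simp flip: power_add)
      then show "c as * list_power (x # xs) as = x ^ e * (x ^ (hd as - e) * g as)"
        unfolding lp[OF as] g_def by (simp only: mult_ac)
    qed
    finally have "x ^ e \<in> C 0 \<or> (\<Sum>as\<in>S. x ^ (hd as - e) * g as) \<in> C 0"
      by (rule prime_ideal_multD[OF P0])
    then have "(\<Sum>as\<in>S. x ^ (hd as - e) * g as) \<in> C 0"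
      using x(2) prime_ideal_power[OF P0] by blast
    moreover have "C 0 \<subseteq> C 1" using Cons.prems(2)[of 0] by simp
    ultimately have all: "(\<Sum>as\<in>S. x ^ (hd as - e) * g as) \<in> C 1" by blast
    have I1: "is_ideal (C 1)" using P1 by (rule prime_ideal_is_ideal)
    have "(\<Sum>as\<in>S - S0. x ^ (hd as - e) * g as) \<in> C 1"
    proof (intro ideal.subspace_sum I1)
      fix as assume "as \<in> S - S0"
      then have "hd as - e \<noteq> 0" using e_le by (force simp: S0_def)
      then have "x dvd x ^ (hd as - e) * g as" by (intro dvd_mult2 dvd_power) simp
      then show "x ^ (hd as - e) * g as \<in> C 1" using ideal_dvd[OF I1 x(1)] by blast
    qed
    with all have "(\<Sum>as\<in>S. x ^ (hd as - e) * g as) - (\<Sum>as\<in>S - S0. x ^ (hd as - e) * g as) \<in> C 1"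
      by (rule ideal.subspace_diff[OF I1])
    also have "(\<Sum>as\<in>S. x ^ (hd as - e) * g as) - (\<Sum>as\<in>S - S0. x ^ (hd as - e) * g as)
        = (\<Sum>as\<in>S0. x ^ (hd as - e) * g as)"
      using S0 fin by (simp add: sum_diff)
    also have "\<dots> = (\<Sum>as\<in>S0. g as)" by (simp add: S0_def)
    also have "\<dots> = (\<Sum>bs\<in>tl ` S0. c (e # bs) * list_power xs bs)"
    proof (subst sum.reindex)
      show "inj_on tl S0"
      proof (rule inj_onI)
        fix as bs assume "as \<in> S0" "bs \<in> S0" "tl as = tl bs"
        then show "as = bs" using ex[of as] ex[of bs] by (simp add: S0_def)
      qed
      show "sum g S0 = sum ((\<lambda>bs. c (e # bs) * list_power xs bs) \<circ> tl) S0"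
      proof (intro sum.cong refl)
        fix as assume "as \<in> S0"
        then show "g as = ((\<lambda>bs. c (e # bs) * list_power xs bs) \<circ> tl) as"
          using ex[of as] by (simp add: g_def S0_def)
      qed
    qed
    finally have "(\<Sum>bs\<in>tl ` S0. c (e # bs) * list_power xs bs) \<in> (C \<circ> Suc) 0" by simp
    moreover have "(\<Sum>bs\<in>tl ` S0. c (e # bs) * list_power xs bs) \<notin> (C \<circ> Suc) 0"
    proof (rule Cons.IH)
      fix bs assume "bs \<in> tl ` S0"
      then obtain as where as: "as \<in> S" "hd as = e" "bs = tl as" by (auto simp: S0_def)
      then have "e # bs = as" using ex[of as] by simp
      then show "c (e # bs) dvd 1" using Cons.prems(7) as by simp
      show "length bs = length xs" using as Cons.prems(6) by simp
    next
      fix i assume "i < length xs"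
      then show "xs ! i \<in> (C \<circ> Suc) (Suc i) - (C \<circ> Suc) i" "(C \<circ> Suc) i \<subseteq> (C \<circ> Suc) (Suc i)"
        using Cons.prems(2,3)[of "Suc i"] by auto
    qed (use Cons.prems(1) S0 in auto)
    ultimately show False by blast
  qed
qed

text \<open>
  Bounding each exponent separately, rather than the total degree, makes counting easy.
\<close>
definition box :: "nat \<Rightarrow> ('n::finite \<Rightarrow>\<^sub>0 nat) set"
  where "box d = {m. \<forall>i. Poly_Mapping.lookup m i \<le> d}"

lemma
  shows finite_box: "finite (box d :: ('n::finite \<Rightarrow>\<^sub>0 nat) set)"
  and card_box_le: "card (box d :: ('n::finite \<Rightarrow>\<^sub>0 nat) set) \<le> Suc d ^ CARD('n)"
proof -
  have inj: "inj_on Poly_Mapping.lookup (box d :: ('n \<Rightarrow>\<^sub>0 nat) set)"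
    by (rule inj_onI) (simp only: poly_mapping_eq_iff)
  have sub: "Poly_Mapping.lookup ` (box d :: ('n \<Rightarrow>\<^sub>0 nat) set) \<subseteq> UNIV \<rightarrow>\<^sub>E {..d}"
    by (intro image_subsetI PiE_I) (simp_all add: box_def)
  have fin: "finite ((UNIV :: 'n set) \<rightarrow>\<^sub>E {..d})"
    by (intro finite_PiE finite finite_atMost)
  show "finite (box d :: ('n \<Rightarrow>\<^sub>0 nat) set)"
    by (rule inj_on_finite[OF inj sub fin])
  show "card (box d :: ('n \<Rightarrow>\<^sub>0 nat) set) \<le> Suc d ^ CARD('n)"
    using card_inj_on_le[OF inj sub fin] by (simp only: card_funcsetE[OF finite] card_atMost)
qed

lemma box_mono:
  assumes "d \<le> e" shows "(box d :: ('n::finite \<Rightarrow>\<^sub>0 nat) set) \<subseteq> box e"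
proof
  fix m :: "'n \<Rightarrow>\<^sub>0 nat"
  assume "m \<in> box d"
  then show "m \<in> box e" using le_trans[OF _ assms] by (simp add: box_def)
qed

lemma keys_mult_box:
  assumes "Poly_Mapping.keys f \<subseteq> box d" "Poly_Mapping.keys g \<subseteq> box e"
  shows "Poly_Mapping.keys (f * g) \<subseteq> box (d + e)"
proof
  fix m assume "m \<in> Poly_Mapping.keys (f * g)"
  then obtain a b where "a \<in> Poly_Mapping.keys f" "b \<in> Poly_Mapping.keys g" "m = a + b"
    using keys_mult[of f g] by blast
  moreover from this have "a \<in> box d" "b \<in> box e" using assms by blast+
  ultimately show "m \<in> box (d + e)" by (simp add: box_def lookup_add add_mono)
qed

lemma keys_power_box:
  fixes f :: "('n::finite, 'k::comm_ring_1) mpoly"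
  assumes "Poly_Mapping.keys f \<subseteq> box d"
  shows "Poly_Mapping.keys (f ^ k) \<subseteq> box (k * d)"
proof (induction k)
  case 0
  then show ?case by (auto simp: box_def)
next
  case (Suc k)
  then show ?case using keys_mult_box[OF assms, of "f ^ k" "k * d"] by simp
qed

lemma keys_list_power_box:
  fixes xs :: "('n::finite, 'k::comm_ring_1) mpoly list"
  assumes "\<And>x. x \<in> set xs \<Longrightarrow> Poly_Mapping.keys x \<subseteq> box d"
    and "length as = length xs" "\<And>a. a \<in> set as \<Longrightarrow> a \<le> N"
  shows "Poly_Mapping.keys (list_power xs as) \<subseteq> box (length xs * (N * d))"
  using assms(2,1,3)
proof (induction as xs rule: list_induct2)
  case Nil
  then show ?case by (auto simp: box_def list_power_def)
next
  case (Cons a as x xs)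
  have "Poly_Mapping.keys (x ^ a) \<subseteq> box (a * d)"
    by (rule keys_power_box) (simp add: Cons.prems)
  also have "\<dots> \<subseteq> box (N * d)"
    by (intro box_mono mult_right_mono) (simp_all add: Cons.prems)
  finally have "Poly_Mapping.keys (x ^ a) \<subseteq> box (N * d)" .
  then have "Poly_Mapping.keys (x ^ a * list_power xs as) \<subseteq> box (N * d + length xs * (N * d))"
    using Cons.IH Cons.prems by (intro keys_mult_box) auto
  then show ?case by (simp add: list_power_def)
qed

lemma in_span_monomials:
  fixes f :: "('n, 'k::field) mpoly"
  assumes "Poly_Mapping.keys f \<subseteq> B"
  shows "f \<in> mpoly.span (monomial ` B)"
proof (subst poly_mapping_sum_single, rule mpoly.span_sum)
  fix m assume "m \<in> Poly_Mapping.keys f"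
  then have "Poly_Mapping.single 0 (Poly_Mapping.lookup f m) * monomial m \<in> mpoly.span (monomial ` B)"
    using assms by (intro mpoly.span_scale mpoly.span_base) auto
  then show "Poly_Mapping.single m (Poly_Mapping.lookup f m) \<in> mpoly.span (monomial ` B)"
    by (simp add: monomial_def mult_single)
qed

text \<open>
  More than \<open>n\<close> polynomials in \<open>n\<close> variables cannot be algebraically independent. The monomials of
  exponents at most \<open>N\<close> in \<open>n + 1\<close> polynomials are \<open>(N + 1)\<^bsup>n + 1\<^esup>\<close> in number, but they lie in a space
  of polynomials whose dimension is at most a constant times \<open>(N + 1)\<^bsup>n\<^esup>\<close>. With
  \<open>prime_chain_independent\<close> this bounds the length of a chain.
\<close>
lemma prime_chain_length_le:
  fixes C :: "nat \<Rightarrow> ('n::finite, 'k::field) mpoly set"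
  assumes prime: "\<And>i. i \<le> k \<Longrightarrow> prime_ideal (C i)"
    and strict: "\<And>i. i < k \<Longrightarrow> C i \<subset> C (Suc i)"
  shows "k \<le> CARD('n)"
proof (rule ccontr)
  let ?n = "CARD('n)"
  assume "\<not> k \<le> ?n"
  then have k: "Suc ?n \<le> k" by linarith
  define x where "x i = (SOME p. p \<in> C (Suc i) - C i)" for i
  have x: "x i \<in> C (Suc i) - C i" if "i < Suc ?n" for i
  proof -
    have "C i \<subset> C (Suc i)" by (rule strict) (use that k in linarith)
    then have "\<exists>p. p \<in> C (Suc i) - C i" by (rule psubset_imp_ex_mem)
    then show ?thesis unfolding x_def by (rule someI_ex)
  qed
  define xs where "xs = map x [0..<Suc ?n]"
  have len: "length xs = Suc ?n" by (simp add: xs_def)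
  have indep: "(\<Sum>as\<in>S. c as * list_power xs as) \<notin> C 0"
    if "finite S" "S \<noteq> {}" "\<And>as. as \<in> S \<Longrightarrow> length as = length xs" "\<And>as. as \<in> S \<Longrightarrow> c as dvd 1"
    for S c
  proof (rule prime_chain_independent[OF _ _ _ that])
    fix i assume i: "i < length xs"
    then have "i < k" using k unfolding len by linarith
    from strict[OF this] show "C i \<subseteq> C (Suc i)" by (rule psubset_imp_subset)
    have "xs ! i = x i" using i unfolding len xs_def by (simp del: upt_Suc)
    then show "xs ! i \<in> C (Suc i) - C i" using x[of i] i unfolding len by simp
  qed (use prime k len in auto)
  have C0: "0 \<in> C 0"
    using prime_ideal_is_ideal[OF prime[of 0]] by (simp add: ideal.subspace_0)
  obtain d where d: "\<And>y. y \<in> set xs \<Longrightarrow> Poly_Mapping.keys y \<subseteq> box d"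
  proof -
    define D where "D = (\<Union>y\<in>set xs. \<Union>m\<in>Poly_Mapping.keys y. Set.range (Poly_Mapping.lookup m))"
    have D: "finite D" by (auto simp: D_def)
    have "Poly_Mapping.keys y \<subseteq> box (Max D)" if "y \<in> set xs" for y
    proof
      fix m assume "m \<in> Poly_Mapping.keys y"
      with that have "Poly_Mapping.lookup m i \<in> D" for i unfolding D_def by blast
      with D show "m \<in> box (Max D)" by (simp add: box_def)
    qed
    then show ?thesis using that by blast
  qed
  \<comment> \<open>The dimension is at most \<open>((N + 1) * c) ^ n\<close>, so \<open>N = c ^ n\<close> is large enough.\<close>
  define c where "c = Suc (Suc ?n * d)"
  define N where "N = c ^ ?n"
  define E where "E = {as. set as \<subseteq> {..N} \<and> length as = Suc ?n}"
  have finE: "finite E" unfolding E_def by (rule finite_lists_length_eq) simp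
  have cardE: "card E = Suc N ^ Suc ?n" unfolding E_def by (subst card_lists_length_eq) auto
  have inj: "inj_on (list_power xs) E"
  proof (rule inj_onI, rule ccontr)
    fix as bs assume *: "as \<in> E" "bs \<in> E" "list_power xs as = list_power xs bs" "as \<noteq> bs"
    have "(\<Sum>cs\<in>{as, bs}. (if cs = as then 1 else - 1) * list_power xs cs) \<notin> C 0"
      using * by (intro indep) (auto simp: E_def len)
    then show False using * C0 by simp
  qed
  have ind: "mpoly.independent (list_power xs ` E)"
    unfolding mpoly.independent_explicit_module
  proof (intro allI impI, rule ccontr)
    fix t u and v :: "('n, 'k) mpoly"
    assume t: "finite t" "t \<subseteq> list_power xs ` E" "(\<Sum>v\<in>t. Poly_Mapping.single 0 (u v) * v) = 0"
      and v: "v \<in> t" "u v \<noteq> 0"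
    define S where "S = {as \<in> E. list_power xs as \<in> t \<and> u (list_power xs as) \<noteq> 0}"
    have img: "list_power xs ` S = {v \<in> t. u v \<noteq> 0}" using t(2) by (auto simp: S_def)
    have "(\<Sum>as\<in>S. Poly_Mapping.single 0 (u (list_power xs as)) * list_power xs as)
        = (\<Sum>v\<in>list_power xs ` S. Poly_Mapping.single 0 (u v) * v)"
      using inj_on_subset[OF inj, of S] by (subst sum.reindex) (auto simp: S_def)
    also have "\<dots> = (\<Sum>v\<in>t. Poly_Mapping.single 0 (u v) * v)"
      unfolding img using t(1) by (intro sum.mono_neutral_left) auto
    finally have "(\<Sum>as\<in>S. Poly_Mapping.single 0 (u (list_power xs as)) * list_power xs as) \<in> C 0"
      using t(3) C0 by simp
    moreover have "(\<Sum>as\<in>S. Poly_Mapping.single 0 (u (list_power xs as)) * list_power xs as) \<notin> C 0"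
    proof (rule indep)
      show "finite S" using finE by (simp add: S_def)
      show "S \<noteq> {}" using img v by auto
      show "length as = length xs" if "as \<in> S" for as using that by (simp add: S_def E_def len)
      show "Poly_Mapping.single 0 (u (list_power xs as)) dvd 1" if "as \<in> S" for as
      proof
        show "1 = Poly_Mapping.single 0 (u (list_power xs as)) *
            Poly_Mapping.single 0 (inverse (u (list_power xs as)))"
          using that by (simp add: S_def mult_single)
      qed
    qed
    ultimately show False by blast
  qed
  have sp: "list_power xs ` E \<subseteq> mpoly.span (monomial ` box (Suc ?n * (N * d)))"
  proof
    fix p assume "p \<in> list_power xs ` E"
    then obtain as where as: "as \<in> E" "p = list_power xs as" by blast
    have "Poly_Mapping.keys p \<subseteq> box (length xs * (N * d))"
      unfolding as(2) using as(1) d by (intro keys_list_power_box) (auto simp: E_def len)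
    then show "p \<in> mpoly.span (monomial ` box (Suc ?n * (N * d)))"
      unfolding len by (rule in_span_monomials)
  qed
  have "card (list_power xs ` E) \<le> card (monomial ` box (Suc ?n * (N * d)) :: ('n, 'k) mpoly set)"
    by (rule mpoly.independent_span_bound[OF finite_imageI[OF finite_box] ind sp, THEN conjunct2])
  also have "\<dots> \<le> card (box (Suc ?n * (N * d)) :: ('n \<Rightarrow>\<^sub>0 nat) set)"
    by (rule card_image_le[OF finite_box])
  also have "\<dots> \<le> Suc (Suc ?n * (N * d)) ^ ?n" by (rule card_box_le)
  also have "\<dots> \<le> (Suc N * c) ^ ?n"
    by (rule power_mono) (simp_all add: c_def algebra_simps)
  also have "\<dots> = Suc N ^ ?n * N" unfolding power_mult_distrib N_def ..
  also have "\<dots> < Suc N ^ ?n * Suc N" by simp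
  also have "\<dots> = card (list_power xs ` E)" using cardE inj by (simp add: card_image)
  finally show False by simp
qed

lemma height_le: "height (P :: ('n::finite, 'k::field) mpoly set) \<le> enat CARD('n)"
  unfolding height_def
proof (rule Sup_least, elim CollectE exE conjE)
  fix e k and C :: "nat \<Rightarrow> ('n, 'k) mpoly set"
  assume e: "e = enat k" and C: "\<forall>i\<le>k. prime_ideal (C i)" "\<forall>i<k. C i \<subset> C (Suc i)"
  have "k \<le> CARD('n)"
    by (rule prime_chain_length_le) (erule C[rule_format])+
  then show "e \<le> enat CARD('n)" by (simp add: e)
qed


section \<open>Minimal vertex covers\<close>

definition vertex_cover :: "'n set set \<Rightarrow> 'n set \<Rightarrow> bool"
  where "vertex_cover F C \<longleftrightarrow> (\<forall>A\<in>F. A \<inter> C \<noteq> {})"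

definition minimal_vertex_cover :: "'n set set \<Rightarrow> 'n set \<Rightarrow> bool"
  where "minimal_vertex_cover F C \<longleftrightarrow> vertex_cover F C \<and> (\<forall>D\<subseteq>C. vertex_cover F D \<longrightarrow> D = C)"

text \<open>
  The indices of the variables in any prime that contains the ideal form a vertex cover.
\<close>
lemma coord_ideal_minimal_prime:
  assumes "minimal_vertex_cover F C"
  shows "coord_ideal C \<in> minimal_primes (sqf_ideal F :: ('n::finite, 'k::field) mpoly set)"
proof -
  have cover: "vertex_cover F C"
    using assms unfolding minimal_vertex_cover_def by (rule conjunct1)
  have min: "D = C" if "D \<subseteq> C" "vertex_cover F D" for D
  proof -
    have "\<forall>D\<subseteq>C. vertex_cover F D \<longrightarrow> D = C"
      using assms unfolding minimal_vertex_cover_def by (rule conjunct2)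
    from this[THEN spec, THEN mp, THEN mp, OF that] show ?thesis .
  qed
  have sub: "sqf_ideal F \<subseteq> (coord_ideal C :: ('n, 'k) mpoly set)"
  proof
    fix f :: "('n, 'k) mpoly" assume f: "f \<in> sqf_ideal F"
    show "f \<in> coord_ideal C"
      unfolding in_coord_ideal_iff
    proof
      fix m assume "m \<in> Poly_Mapping.keys f"
      with f[unfolded in_sqf_ideal_iff] have "\<exists>A\<in>F. A \<subseteq> Poly_Mapping.keys m" by (rule bspec)
      then obtain A where A: "A \<in> F" "A \<subseteq> Poly_Mapping.keys m" by (rule bexE)
      from cover[unfolded vertex_cover_def] A(1) have "A \<inter> C \<noteq> {}" by (rule bspec)
      with A(2) show "C \<inter> Poly_Mapping.keys m \<noteq> {}" by blast
    qed
  qed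
  have least: "Q = coord_ideal C"
    if Q: "prime_ideal Q" "sqf_ideal F \<subseteq> Q" "Q \<subseteq> coord_ideal C" for Q :: "('n, 'k) mpoly set"
  proof
    define D where "D = {i. (sqf_monomial {i} :: ('n, 'k) mpoly) \<in> Q}"
    have "vertex_cover F D"
      unfolding vertex_cover_def
    proof (rule ballI)
      fix A assume "A \<in> F"
      then have "\<exists>B\<in>F. B \<subseteq> A" by blast
      then have "(sqf_monomial A :: ('n, 'k) mpoly) \<in> sqf_ideal F"
        unfolding sqf_monomial_in_sqf_ideal_iff .
      then have "(sqf_monomial A :: ('n, 'k) mpoly) \<in> Q" by (rule subsetD[OF Q(2)])
      then have "(\<Prod>i\<in>A. sqf_monomial {i} :: ('n, 'k) mpoly) \<in> Q"
        by (subst (asm) sqf_monomial_conv_prod)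
      then have "\<exists>i\<in>A. (sqf_monomial {i} :: ('n, 'k) mpoly) \<in> Q"
        by (rule prime_ideal_prod[OF Q(1) finite])
      then show "A \<inter> D \<noteq> {}" by (auto simp: D_def)
    qed
    moreover have "D \<subseteq> C"
    proof
      fix i assume "i \<in> D"
      then have "(sqf_monomial {i} :: ('n, 'k) mpoly) \<in> coord_ideal C"
        unfolding D_def using Q(3) by blast
      then show "i \<in> C" unfolding variable_in_coord_ideal_iff .
    qed
    ultimately have "D = C" by (intro min)
    then have "sqf_monomial ` (\<lambda>i. {i}) ` C \<subseteq> Q" by (auto simp: D_def)
    then show "coord_ideal C \<subseteq> Q"
      unfolding coord_ideal_def sqf_ideal_def
      by (rule ideal.span_minimal) (rule prime_ideal_is_ideal[OF Q(1)])
  qed (rule Q(3))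
  show ?thesis
    unfolding minimal_primes_def
    by (intro CollectI conjI allI impI prime_ideal_coord_ideal sub, elim conjE) (rule least)
qed

text \<open>
  The finiteness of heights enters here: it makes \<open>\<tau>\<close> a finite number, so that \<open>the_enat\<close> returns
  its value.
\<close>
lemma card_minimal_vertex_cover_le_tau:
  assumes "minimal_vertex_cover F C"
  shows "card C \<le> the_enat (tau (sqf_ideal F :: ('n::finite, 'k::field) mpoly set))"
proof -
  let ?t = "tau (sqf_ideal F :: ('n, 'k) mpoly set)"
  have "?t \<le> enat CARD('n)"
    unfolding tau_def by (rule SUP_least) (rule height_le)
  then obtain t where t: "?t = enat t" using enat_ile by blast
  have "enat (card C) \<le> ?t"
    unfolding tau_def
    using coord_ideal_minimal_prime[OF assms] card_le_height_coord_ideal by (rule SUP_upper2)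
  then show ?thesis by (simp add: t)
qed

text \<open>
  The pigeonhole argument: a vertex cover by at most \<open>t\<close> indices of degree below \<open>card F / t\<close> would
  be incident with fewer than \<open>card F\<close> members. The division is avoided by multiplying with \<open>t\<close>.
\<close>
lemma ex_member_of_large_degrees:
  fixes F :: "'n::finite set set"
  assumes F: "F \<noteq> {}" and t: "\<And>C. minimal_vertex_cover F C \<Longrightarrow> card C \<le> t"
  shows "\<exists>A\<in>F. \<forall>i\<in>A. card F \<le> t * card {B\<in>F. i \<in> B}"
proof (rule ccontr)
  define deg where "deg i = card {B\<in>F. i \<in> B}" for i
  define low where "low = {i. t * deg i < card F}"
  assume neg: "\<not> (\<exists>A\<in>F. \<forall>i\<in>A. card F \<le> t * card {B\<in>F. i \<in> B})"
  have "vertex_cover F low"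
    unfolding vertex_cover_def
  proof
    fix A assume "A \<in> F"
    with neg obtain i where "i \<in> A" "\<not> card F \<le> t * deg i" unfolding deg_def by blast
    then have "i \<in> A \<inter> low" by (simp add: low_def)
    then show "A \<inter> low \<noteq> {}" by blast
  qed
  then have "low \<in> Collect (vertex_cover F)" by (rule CollectI)
  from finite_has_minimal2[OF finite this] obtain C
    where C': "C \<in> Collect (vertex_cover F)" "C \<subseteq> low"
      and min: "\<forall>D\<in>Collect (vertex_cover F). D \<subseteq> C \<longrightarrow> C = D"
    by (elim bexE conjE)
  then have C: "C \<subseteq> low" "vertex_cover F C" by simp_all
  have mvc: "minimal_vertex_cover F C"
    unfolding minimal_vertex_cover_def
  proof (intro conjI allI impI C(2))
    fix D assume "D \<subseteq> C" "vertex_cover F D"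
    then have "C = D" by (intro min[THEN bspec, THEN mp]) (rule CollectI)
    then show "D = C" by (rule sym)
  qed
  have cover: "\<exists>i\<in>C. i \<in> A" if "A \<in> F" for A
  proof -
    have "A \<inter> C \<noteq> {}" using C(2)[unfolded vertex_cover_def] that by (rule bspec)
    then show ?thesis by blast
  qed
  have "C \<noteq> {}" using F cover by auto
  have "F \<subseteq> (\<Union>i\<in>C. {B\<in>F. i \<in> B})" using cover by auto
  then have "card F \<le> card (\<Union>i\<in>C. {B\<in>F. i \<in> B})" by (rule card_mono[OF finite])
  also have "\<dots> \<le> (\<Sum>i\<in>C. deg i)" unfolding deg_def by (rule card_UN_le) (rule finite)
  finally have "t * card F \<le> t * (\<Sum>i\<in>C. deg i)" by (rule mult_le_mono2)
  also have "\<dots> = (\<Sum>i\<in>C. t * deg i)" by (rule sum_distrib_left)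
  also have "\<dots> < (\<Sum>i\<in>C. card F)"
  proof (rule sum_strict_mono)
    fix i assume "i \<in> C"
    then show "t * deg i < card F" using C(1) by (auto simp: low_def)
  qed (use \<open>C \<noteq> {}\<close> in simp_all)
  also have "\<dots> = card C * card F" by simp
  also have "\<dots> \<le> t * card F" by (rule mult_le_mono1) (rule t[OF mvc])
  finally show False by simp
qed


section \<open>The bound on the arithmetical rank\<close>

text \<open>
  The generators up to radical are \<open>x\<^sub>A\<close> and the first \<open>card F - d\<close> elementary symmetric elements of
  the other generators. Fewer than \<open>card F - d + 1\<close> members of \<open>F\<close> avoid a given \<open>i \<in> A\<close>, so any larger
  subfamily covers \<open>A\<close>, and \<open>x\<^sub>A\<close> divides the product of its monomials.
\<close>
lemma ara_le_of_min_degree: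
  fixes J :: "('n::finite, 'k::field) mpoly set" and F :: "'n set set"
  assumes I: "radical J = sqf_ideal F" and A: "A \<in> F"
    and deg: "\<And>i. i \<in> A \<Longrightarrow> d \<le> card {B\<in>F. i \<in> B}"
  shows "ara J \<le> Suc (card F - d)"
proof -
  let ?x = "sqf_monomial :: 'n set \<Rightarrow> ('n, 'k) mpoly"
  let ?I = "sqf_ideal F :: ('n, 'k) mpoly set"
  define H where "H = F - {A}"
  define r where "r = card F - d"
  define as where "as = ?x A # map (esym ?x H) [1..<Suc r]"
  have gens: "?x B \<in> ?I" if "B \<in> F" for B
    using that sqf_monomial_in_sqf_ideal_iff by blast
  have "?x A dvd prod ?x S" if S: "S \<subseteq> H" "r < card S" for S
  proof (rule sqf_monomial_dvd_prod, rule subsetI, rule ccontr)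
    fix i assume i: "i \<in> A" "i \<notin> \<Union>S"
    then have "S \<subseteq> F - {B\<in>F. i \<in> B}" using S by (auto simp: H_def)
    then have "card S \<le> card (F - {B\<in>F. i \<in> B})" by (intro card_mono) auto
    also have "\<dots> = card F - card {B\<in>F. i \<in> B}" by (intro card_Diff_subset) auto
    also have "\<dots> \<le> r" using deg[OF i(1)] by (simp add: r_def)
    finally show False using S by simp
  qed
  then have "?x B \<in> radical (ideal_gen (set as))" if "B \<in> H" for B
    unfolding as_def using that by (intro in_radical_esym) auto
  moreover have "?x A \<in> radical (ideal_gen (set as))"
    using subset_radical ideal.span_base[of "?x A" "set as"] by (auto simp: as_def)
  ultimately have "?x ` F \<subseteq> radical (ideal_gen (set as))"
    unfolding H_def by blast
  then have "?I \<subseteq> radical (ideal_gen (set as))"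
    unfolding sqf_ideal_def
    by (rule ideal.span_minimal) (intro is_ideal_radical ideal.subspace_span)
  moreover have "radical (ideal_gen (set as)) \<subseteq> ?I"
  proof -
    have "esym ?x H j \<in> ?I" if "1 \<le> j" for j
      unfolding esym_def
    proof (intro ideal.subspace_sum is_ideal_sqf_ideal)
      fix S assume "S \<in> {S. S \<subseteq> H \<and> card S = j}"
      then have S: "S \<subseteq> H" "card S = j" by auto
      then obtain B where B: "B \<in> S" using \<open>1 \<le> j\<close> by fastforce
      then have "?x B dvd prod ?x S" by (intro dvd_prodI) auto
      moreover have "B \<in> F" using B S by (auto simp: H_def)
      ultimately show "prod ?x S \<in> ?I" using ideal_dvd[OF is_ideal_sqf_ideal gens] by blast
    qed
    then have "set as \<subseteq> ?I" using gens[OF A] by (auto simp: as_def)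
    then have "ideal_gen (set as) \<subseteq> ?I" by (rule ideal.span_minimal) (rule is_ideal_sqf_ideal)
    then have "radical (ideal_gen (set as)) \<subseteq> radical ?I" by (rule radical_mono)
    also have "radical ?I = ?I" unfolding I[symmetric] by (rule radical_idem)
    finally show ?thesis .
  qed
  ultimately have "radical (ideal_gen (set as)) = radical J" using I by blast
  then have "ara J \<le> length as" by (rule ara_le)
  then show ?thesis by (simp add: as_def r_def del: upt_Suc)
qed

theorem corollary1:
  fixes J I :: "('n::finite, 'k::field) mpoly set"
  assumes "is_ideal J"
    and "I = radical J"
    and "monomial_ideal I"
    and "I \<noteq> {0}"
    and "I \<noteq> UNIV"
  shows "rat_of_nat (ara J) \<le>
           rat_of_nat (mu I) - rat_of_nat (mu I) / rat_of_nat (the_enat (tau I)) + 1"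
proof -
  obtain F where antichain: "\<And>A B. A \<in> F \<Longrightarrow> B \<in> F \<Longrightarrow> A \<subseteq> B \<Longrightarrow> A = B"
    and F: "radical J = sqf_ideal F"
    using radical_monomial_ideal_squarefree[OF assms(1)] assms(2,3) by blast
  have I: "I = sqf_ideal F" using F assms(2) by simp
  define t where "t = the_enat (tau I)"
  have "F \<noteq> {}"
  proof
    assume "F = {}"
    then have "I = {0}" unfolding I by (simp add: sqf_ideal_def)
    with assms(4) show False by blast
  qed
  have "{} \<notin> F"
  proof
    assume "{} \<in> F"
    then have "f \<in> I" for f unfolding I in_sqf_ideal_iff by blast
    with assms(5) show False by blast
  qed
  have "\<exists>A\<in>F. \<forall>i\<in>A. card F \<le> t * card {B\<in>F. i \<in> B}"
    using \<open>F \<noteq> {}\<close> card_minimal_vertex_cover_le_tau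
    unfolding t_def I by (rule ex_member_of_large_degrees)
  then obtain A where A: "A \<in> F" "\<And>i. i \<in> A \<Longrightarrow> card F \<le> t * card {B\<in>F. i \<in> B}" by blast
  then have "A \<noteq> {}" using \<open>{} \<notin> F\<close> by blast
  define d where "d = (MIN i\<in>A. card {B\<in>F. i \<in> B})"
  have d_le: "d \<le> card {B\<in>F. i \<in> B}" if "i \<in> A" for i
    using that by (simp add: d_def)
  have "d \<in> (\<lambda>i. card {B\<in>F. i \<in> B}) ` A"
    unfolding d_def using \<open>A \<noteq> {}\<close> by (intro Min_in) auto
  then obtain i where i: "i \<in> A" "d = card {B\<in>F. i \<in> B}" by blast
  have "d \<le> card F" unfolding i by (intro card_mono) auto
  have "rat_of_nat (ara J) \<le> rat_of_nat (Suc (card F - d))"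
    using ara_le_of_min_degree[OF F A(1) d_le] by (simp only: of_nat_le_iff)
  also have "\<dots> = rat_of_nat (card F) - rat_of_nat d + 1"
    using \<open>d \<le> card F\<close> by (simp add: of_nat_diff)
  finally have 1: "rat_of_nat (ara J) \<le> rat_of_nat (card F) - rat_of_nat d + 1" .
  have "card F \<le> t * d" using A(2)[OF i(1)] i(2) by simp
  then have 2: "rat_of_nat (card F) \<le> rat_of_nat t * rat_of_nat d"
    by (metis of_nat_le_iff of_nat_mult)
  have "card F > 0" using \<open>F \<noteq> {}\<close> by (simp add: card_gt_0_iff)
  then have "t > 0" using \<open>card F \<le> t * d\<close> by (cases t) auto
  then have t: "rat_of_nat t \<ge> 1" by simp
  have mu: "rat_of_nat (card F) \<le> rat_of_nat (mu I)"
    unfolding I of_nat_le_iff by (rule card_le_mu_sqf_ideal[OF antichain])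
  have "rat_of_nat (card F) / rat_of_nat t \<le> rat_of_nat d"
    using 2 t by (simp add: field_simps)
  \<comment> \<open>Monotonicity of \<open>\<mu> - \<mu> / \<tau>\<close> in \<open>\<mu>\<close>, which uses \<open>\<tau> \<ge> 1\<close>.\<close>
  moreover have "(rat_of_nat (mu I) - rat_of_nat (card F)) / rat_of_nat t \<le> rat_of_nat (mu I) - rat_of_nat (card F)"
    using mu t by (simp add: divide_le_eq mult_le_cancel_left1)
  ultimately show ?thesis
    using 1 unfolding t_def[symmetric] by (simp add: diff_divide_distrib)
qed

end
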